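(* The exorcism group $\mathbb{X}_0(\mathbf{CG})$ is isomorphic to the group of formal power series of the form $1+\sum_{n\ge1}t_nx^n$ (with $t_n\in\Bbbk$) under multiplication.
   Context: Let $\Bbbk$ be a field of characteristic 0. $\mathbf{CG}$ is the Hopf algebra of lattices of order ideals of chain gangs with phantoms; concretely, as a graded algebra $\mathbf{CG}=\Bbbk[F,C_1,C_2,\dots]$ is the free polynomial algebra on $F$ (degree 1, a single phantom) and $C_n$ (degree $n$, the chain of order ideals of an $n$-element chain), with $C_0=1$, and its coproduct is the algebra morphism determined by $\Delta(F)=1\otimes F+F\otimes1$ and $\Delta(C_n)=1\otimes C_n+\sum_{m=1}^n\sum_{j=0}^{n-m}\binom{n-m}{j}C_{j+1}\otimes C_{m-1}F^{n-m-j}$. A character of $\mathbf{CG}$ is a unital algebra homomorphism $\zeta:\mathbf{CG}\to\Bbbk$; characters form a group $\mathbb{X}(\mathbf{CG})$ under convolution $(\chi*\phi)(x)=\sum\chi(x_{(1)})\phi(x_{(2)})$, where $\Delta(x)=\sum x_{(1)}\otimes x_{(2)}$, with identity the counit and inverse $\chi\circ\mathrm{S}$. The exorcism group is the subgroup $\mathbb{X}_0(\mathbf{CG})=\{\zeta\in\mathbb{X}(\mathbf{CG}):\zeta(F)=0\}$. *)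

theory Defs
  imports
    "HOL-Library.Poly_Mapping"
    "HOL-Library.Product_Plus"
    "HOL-Computational_Algebra.Formal_Power_Series"
    "HOL-Algebra.Group"
begin

section \<open>The algebra CG\<close>

text \<open>The generators are a single phantom and one chain for every positive length;
  \<open>Chain n\<close> stands for the chain of length \<open>n + 1\<close>, so that there is no generator for
  the empty chain.\<close>

datatype gen = Phantom | Chain nat

type_synonym mon = "gen \<Rightarrow>\<^sub>0 nat"

text \<open>Polynomials are finitely supported functions from commutative monomials to coefficients.
  The library product on this type is convolution, i.e. multiplication of polynomials, and
  \<open>single 0 c\<close> is the constant polynomial \<open>c\<close>.\<close>

type_synonym 'k CG = "mon \<Rightarrow>\<^sub>0 'k"

definition F :: "'k::field_char_0 CG" where
  "F = Poly_Mapping.single (Poly_Mapping.single Phantom 1) 1"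

fun C :: "nat \<Rightarrow> 'k::field_char_0 CG" where
  "C 0 = 1"
| "C (Suc n) = Poly_Mapping.single (Poly_Mapping.single (Chain n) 1) 1"


section \<open>The tensor square and the coproduct\<close>

text \<open>Pairs of monomials form a basis of the tensor square of CG, and they multiply
  componentwise.  Hence the algebra \<open>CG \<otimes> CG\<close> is the algebra of the product monoid
  \<open>mon \<times> mon\<close>, the pair \<open>(m, n)\<close> corresponding to \<open>m \<otimes> n\<close>.\<close>

type_synonym 'k CG2 = "(mon \<times> mon) \<Rightarrow>\<^sub>0 'k"

definition tensor :: "'k::field_char_0 CG \<Rightarrow> 'k CG \<Rightarrow> 'k CG2"  (infixr \<open>\<otimes>\<^sub>t\<close> 75) where
  "a \<otimes>\<^sub>t b = (\<Sum>m\<in>Poly_Mapping.keys a. \<Sum>n\<in>Poly_Mapping.keys b.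
     Poly_Mapping.single (m, n) (Poly_Mapping.lookup a m * Poly_Mapping.lookup b n))"

fun coproduct_gen :: "gen \<Rightarrow> 'k::field_char_0 CG2" where
  "coproduct_gen Phantom = 1 \<otimes>\<^sub>t F + F \<otimes>\<^sub>t 1"
| "coproduct_gen (Chain k) = (let n = Suc k in
     1 \<otimes>\<^sub>t C n +
     (\<Sum>m = 1..n. \<Sum>j = 0..n - m.
        of_nat ((n - m) choose j) * (C (j + 1) \<otimes>\<^sub>t (C (m - 1) * F ^ (n - m - j)))))"

text \<open>Substitution of the values on generators; \<open>coproduct_algebra_hom\<close>, \<open>coproduct_F\<close>,
  \<open>coproduct_C\<close> and \<open>coproduct_unique\<close> below characterise this map.\<close>

definition coproduct :: "'k::field_char_0 CG \<Rightarrow> 'k CG2" where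
  "coproduct x = (\<Sum>m\<in>Poly_Mapping.keys x.
     Poly_Mapping.single 0 (Poly_Mapping.lookup x m) *
     (\<Prod>g\<in>Poly_Mapping.keys m. coproduct_gen g ^ Poly_Mapping.lookup m g))"


section \<open>Characters and the exorcism group\<close>

definition character :: "('k::field_char_0 CG \<Rightarrow> 'k) \<Rightarrow> bool" where
  "character \<zeta> \<longleftrightarrow>
     (\<forall>x y. \<zeta> (x + y) = \<zeta> x + \<zeta> y) \<and>
     (\<forall>c x. \<zeta> (Poly_Mapping.single 0 c * x) = c * \<zeta> x) \<and>
     (\<forall>x y. \<zeta> (x * y) = \<zeta> x * \<zeta> y) \<and>
     \<zeta> 1 = 1"

text \<open>The linear map on the tensor square with \<open>a \<otimes> b \<mapsto> \<chi> a * \<phi> b\<close>, for linear \<open>\<chi>\<close> and \<open>\<phi>\<close>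
  (see \<open>tensor_eval_tensor\<close> below).\<close>

definition tensor_eval ::
    "('k::field_char_0 CG \<Rightarrow> 'k) \<Rightarrow> ('k CG \<Rightarrow> 'k) \<Rightarrow> 'k CG2 \<Rightarrow> 'k" where
  "tensor_eval \<chi> \<phi> t = (\<Sum>(m, n)\<in>Poly_Mapping.keys t. Poly_Mapping.lookup t (m, n) *
     (\<chi> (Poly_Mapping.single m 1) * \<phi> (Poly_Mapping.single n 1)))"

definition convolution ::
    "('k::field_char_0 CG \<Rightarrow> 'k) \<Rightarrow> ('k CG \<Rightarrow> 'k) \<Rightarrow> 'k CG \<Rightarrow> 'k" where
  "convolution \<chi> \<phi> x = tensor_eval \<chi> \<phi> (coproduct x)"

text \<open>The grading makes CG connected, so its counit is the constant coefficient.\<close>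

definition counit :: "'k::field_char_0 CG \<Rightarrow> 'k" where
  "counit x = Poly_Mapping.lookup x 0"

definition character_group :: "('k::field_char_0 CG \<Rightarrow> 'k) monoid" where
  "character_group = \<lparr>carrier = {\<zeta>. character \<zeta>}, mult = convolution, one = counit\<rparr>"

definition exorcism_group :: "('k::field_char_0 CG \<Rightarrow> 'k) monoid" where
  "exorcism_group = character_group \<lparr>carrier := {\<zeta> \<in> carrier character_group. \<zeta> F = 0}\<rparr>"

definition unit_series_group :: "'k::field_char_0 fps monoid" where
  "unit_series_group = \<lparr>carrier = {f. fps_nth f 0 = 1}, mult = (*), one = 1\<rparr>"


section \<open>Characterisation of the tensor square and of the coproduct\<close>

lemma poly_mapping_sum_single:
  "(\<Sum>m\<in>Poly_Mapping.keys x. Poly_Mapping.single m (Poly_Mapping.lookup x m)) = x"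
proof (rule poly_mapping_eqI)
  fix k
  show "Poly_Mapping.lookup (\<Sum>m\<in>Poly_Mapping.keys x.
      Poly_Mapping.single m (Poly_Mapping.lookup x m)) k = Poly_Mapping.lookup x k"
    by (auto simp: lookup_sum lookup_single when_def in_keys_iff)
qed

lemma poly_mapping_add_induct [case_names single add]:
  fixes x :: "'a \<Rightarrow>\<^sub>0 'b::comm_monoid_add"
  assumes single: "\<And>m c. P (Poly_Mapping.single m c)"
    and add: "\<And>x y. P x \<Longrightarrow> P y \<Longrightarrow> P (x + y)"
  shows "P x"
proof -
  have zero: "P 0"
    using single[of undefined 0] by simp
  have "P (\<Sum>m\<in>A. Poly_Mapping.single m (Poly_Mapping.lookup x m))" if "finite A" for A
    using that by (induction rule: finite_induct) (auto intro: single add zero)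
  then show ?thesis
    using poly_mapping_sum_single[of x] by (metis finite_keys)
qed

lemma tensor_add_left: "(a + b) \<otimes>\<^sub>t c = a \<otimes>\<^sub>t c + b \<otimes>\<^sub>t c"
  unfolding tensor_def
  by (rule setsum_keys_plus_distrib)
     (simp_all add: ring_distribs single_add sum.distrib)

lemma tensor_add_right: "a \<otimes>\<^sub>t (b + c) = a \<otimes>\<^sub>t b + a \<otimes>\<^sub>t c"
proof -
  have "(\<Sum>n\<in>Poly_Mapping.keys (b + c).
      Poly_Mapping.single (m, n) (Poly_Mapping.lookup a m * Poly_Mapping.lookup (b + c) n)) =
    (\<Sum>n\<in>Poly_Mapping.keys b.
      Poly_Mapping.single (m, n) (Poly_Mapping.lookup a m * Poly_Mapping.lookup b n)) +
    (\<Sum>n\<in>Poly_Mapping.keys c.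
      Poly_Mapping.single (m, n) (Poly_Mapping.lookup a m * Poly_Mapping.lookup c n))" for m
    by (rule setsum_keys_plus_distrib) (simp_all add: ring_distribs single_add)
  then show ?thesis
    by (simp add: tensor_def sum.distrib)
qed

lemma tensor_single:
  "Poly_Mapping.single m a \<otimes>\<^sub>t Poly_Mapping.single n b = Poly_Mapping.single (m, n) (a * b)"
  by (simp add: tensor_def)

lemma tensor_mult: "(a \<otimes>\<^sub>t b) * (c \<otimes>\<^sub>t d) = (a * c) \<otimes>\<^sub>t (b * d)"
proof (induction a rule: poly_mapping_add_induct)
  case (single m u)
  show ?case
  proof (induction b rule: poly_mapping_add_induct)
    case (single n v)
    show ?case
    proof (induction c rule: poly_mapping_add_induct)
      case (single p w)
      show ?case
        by (induction d rule: poly_mapping_add_induct)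
          (simp_all add: tensor_single mult_single ac_simps ring_distribs tensor_add_right)
    qed (simp add: ring_distribs tensor_add_left)
  qed (simp add: ring_distribs tensor_add_left tensor_add_right)
qed (simp add: ring_distribs tensor_add_left)

lemma tensor_one: "1 \<otimes>\<^sub>t 1 = 1"
  using tensor_single[of 0 1 0 1] by (simp flip: zero_prod_def)

lemma tensor_eval_add: "tensor_eval \<chi> \<phi> (s + t) = tensor_eval \<chi> \<phi> s + tensor_eval \<chi> \<phi> t"
  unfolding tensor_eval_def split_def prod.collapse
  by (rule setsum_keys_plus_distrib) (simp_all add: ring_distribs)

lemma tensor_eval_tensor:
  assumes "\<And>x y. \<chi> (x + y) = \<chi> x + \<chi> y" "\<And>c x. \<chi> (Poly_Mapping.single 0 c * x) = c * \<chi> x"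
    and "\<And>x y. \<phi> (x + y) = \<phi> x + \<phi> y" "\<And>c x. \<phi> (Poly_Mapping.single 0 c * x) = c * \<phi> x"
  shows "tensor_eval \<chi> \<phi> (a \<otimes>\<^sub>t b) = \<chi> a * \<phi> b"
proof (induction a rule: poly_mapping_add_induct)
  case (single m u)
  show ?case
  proof (induction b rule: poly_mapping_add_induct)
    case (single n v)
    have "\<chi> (Poly_Mapping.single m u) = u * \<chi> (Poly_Mapping.single m 1)"
      using assms(2)[of u "Poly_Mapping.single m 1"] by (simp add: mult_single)
    moreover have "\<phi> (Poly_Mapping.single n v) = v * \<phi> (Poly_Mapping.single n 1)"
      using assms(4)[of v "Poly_Mapping.single n 1"] by (simp add: mult_single)
    ultimately show ?case
      by (simp add: tensor_single tensor_eval_def)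
  qed (simp add: assms tensor_add_right tensor_eval_add ring_distribs)
qed (simp add: assms tensor_add_left tensor_eval_add ring_distribs)

text \<open>Unital algebra homomorphisms from CG to its tensor square.\<close>

definition CG2_hom :: "('k::field_char_0 CG \<Rightarrow> 'k CG2) \<Rightarrow> bool" where
  "CG2_hom f \<longleftrightarrow>
     (\<forall>x y. f (x + y) = f x + f y) \<and>
     (\<forall>c x. f (Poly_Mapping.single 0 c * x) = Poly_Mapping.single 0 c * f x) \<and>
     (\<forall>x y. f (x * y) = f x * f y) \<and>
     f 1 = 1"

definition coproduct_mon :: "mon \<Rightarrow> 'k::field_char_0 CG2" where
  "coproduct_mon m = (\<Prod>g\<in>Poly_Mapping.keys m. coproduct_gen g ^ Poly_Mapping.lookup m g)"

lemma coproduct_mon_superset: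
  assumes "finite A" "Poly_Mapping.keys m \<subseteq> A"
  shows "coproduct_mon m = (\<Prod>g\<in>A. coproduct_gen g ^ Poly_Mapping.lookup m g)"
  unfolding coproduct_mon_def using assms
  by (intro prod.mono_neutral_left) (auto simp: in_keys_iff)

lemma coproduct_mon_add: "coproduct_mon (m + n) = coproduct_mon m * coproduct_mon n"
proof -
  let ?A = "Poly_Mapping.keys m \<union> Poly_Mapping.keys n"
  have "coproduct_mon (m + n) = (\<Prod>g\<in>?A. coproduct_gen g ^ Poly_Mapping.lookup (m + n) g)"
    by (rule coproduct_mon_superset) (auto simp: Poly_Mapping.keys_add)
  also have "\<dots> = (\<Prod>g\<in>?A. coproduct_gen g ^ Poly_Mapping.lookup m g) *
      (\<Prod>g\<in>?A. coproduct_gen g ^ Poly_Mapping.lookup n g)"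
    by (simp add: lookup_add power_add prod.distrib)
  also have "\<dots> = coproduct_mon m * coproduct_mon n"
    by (simp add: coproduct_mon_superset[of ?A])
  finally show ?thesis .
qed

lemma coproduct_add: "coproduct (x + y) = coproduct x + coproduct y"
  unfolding coproduct_def
  by (rule setsum_keys_plus_distrib) (simp_all add: single_add ring_distribs)

lemma coproduct_single:
  "coproduct (Poly_Mapping.single m c) = Poly_Mapping.single 0 c * coproduct_mon m"
  by (simp add: coproduct_def coproduct_mon_def)

lemma coproduct_mult: "coproduct (x * y) = coproduct x * coproduct y"
proof (induction x rule: poly_mapping_add_induct)
  case (single m u)
  show ?case
  proof (induction y rule: poly_mapping_add_induct)
    case (single n v)
    have "Poly_Mapping.single 0 (u * v) =
        (Poly_Mapping.single 0 u * Poly_Mapping.single 0 v :: 'a CG2)"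
      by (simp add: mult_single)
    then show ?case
      by (simp add: mult_single[of m] coproduct_single coproduct_mon_add ac_simps)
  qed (simp add: coproduct_add ring_distribs)
qed (simp add: coproduct_add ring_distribs)

lemma coproduct_const: "coproduct (Poly_Mapping.single 0 c) = Poly_Mapping.single 0 c"
  by (simp add: coproduct_single coproduct_mon_def)

lemma coproduct_one: "coproduct 1 = 1"
  using coproduct_const[of 1] by simp

lemma coproduct_algebra_hom: "CG2_hom coproduct"
  by (simp add: CG2_hom_def coproduct_add coproduct_mult coproduct_const coproduct_one)

lemma coproduct_var:
  "coproduct (Poly_Mapping.single (Poly_Mapping.single g 1) 1) = coproduct_gen g"
  by (simp add: coproduct_single coproduct_mon_def)

lemma coproduct_F: "coproduct F = 1 \<otimes>\<^sub>t F + F \<otimes>\<^sub>t 1"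
  by (metis F_def coproduct_gen.simps(1) coproduct_var)

lemma coproduct_C:
  "coproduct (C n) = 1 \<otimes>\<^sub>t C n +
     (\<Sum>m = 1..n. \<Sum>j = 0..n - m.
        of_nat ((n - m) choose j) * (C (j + 1) \<otimes>\<^sub>t (C (m - 1) * F ^ (n - m - j))))"
proof (cases n)
  case 0
  then show ?thesis by (simp add: coproduct_one tensor_one)
next
  case (Suc k)
  have "coproduct (C (Suc k)) = coproduct_gen (Chain k)"
    by (simp only: C.simps coproduct_var)
  then show ?thesis
    by (simp only: Suc coproduct_gen.simps Let_def)
qed

lemma coproduct_unique:
  assumes f: "CG2_hom f" and F: "f F = coproduct F" and C: "\<And>n. f (C n) = coproduct (C n)"
  shows "f = coproduct"
proof
  fix x
  have f_add: "f (x + y) = f x + f y" and f_mult: "f (x * y) = f x * f y"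
    and f_scale: "f (Poly_Mapping.single 0 c * x) = Poly_Mapping.single 0 c * f x"
    and f_one: "f 1 = 1" for x y c
    using f unfolding CG2_hom_def by blast+
  have var: "f (Poly_Mapping.single (Poly_Mapping.single g 1) 1) =
      coproduct (Poly_Mapping.single (Poly_Mapping.single g 1) 1)" for g
    using F C[of "Suc _"] by (cases g) (simp_all add: F_def)
  have pow: "f (Poly_Mapping.single (Poly_Mapping.single g k) 1) =
      coproduct (Poly_Mapping.single (Poly_Mapping.single g k) 1)" for g k
  proof (induction k)
    case 0
    then show ?case by (simp add: f_one coproduct_one)
  next
    case (Suc k)
    have "Poly_Mapping.single (Poly_Mapping.single g (Suc k)) (1::'a) =
        Poly_Mapping.single (Poly_Mapping.single g 1) 1 *
        Poly_Mapping.single (Poly_Mapping.single g k) 1"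
      by (simp add: mult_single flip: single_add)
    then show ?case
      by (simp only: f_mult coproduct_mult var Suc)
  qed
  have mon: "f (Poly_Mapping.single m 1) = coproduct (Poly_Mapping.single m 1)" for m
  proof (induction m rule: poly_mapping_add_induct)
    case (single g k)
    show ?case by (rule pow)
  next
    case (add m n)
    have "Poly_Mapping.single (m + n) (1::'a) =
        Poly_Mapping.single m 1 * Poly_Mapping.single n 1"
      by (simp add: mult_single)
    then show ?case
      by (simp only: f_mult coproduct_mult add)
  qed
  show "f x = coproduct x"
  proof (induction x rule: poly_mapping_add_induct)
    case (single m c)
    have "Poly_Mapping.single m c = Poly_Mapping.single 0 c * Poly_Mapping.single m 1"
      by (simp add: mult_single)
    then show ?case
      by (simp only: f_scale mon coproduct_mult coproduct_const)
  qed (simp add: f_add coproduct_add)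
qed

end

(* A character vanishing on F is an arbitrary assignment of scalars to C_1, C_2, ....  If
   phi(F) = 0, then in phi applied to the right-hand factors of Delta(C_n) only the terms with
   j = n - m survive, and the convolution of chi and phi sends C_n to the sum of
   chi(C_i) phi(C_{n-i}).  Hence the generating function of the values on chains is
   multiplicative. *)

theory Submission
  imports Defs
begin

section \<open>Characters as evaluations of polynomials\<close>

lemma character_add: "character \<zeta> \<Longrightarrow> \<zeta> (x + y) = \<zeta> x + \<zeta> y"
  and character_scale: "character \<zeta> \<Longrightarrow> \<zeta> (Poly_Mapping.single 0 c * x) = c * \<zeta> x"
  and character_mult: "character \<zeta> \<Longrightarrow> \<zeta> (x * y) = \<zeta> x * \<zeta> y"
  and character_one: "character \<zeta> \<Longrightarrow> \<zeta> 1 = 1"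
  unfolding character_def by blast+

lemma character_power: "character \<zeta> \<Longrightarrow> \<zeta> (x ^ n) = \<zeta> x ^ n"
  by (induction n) (simp_all add: character_one character_mult)

lemma character_single:
  assumes "character \<zeta>"
  shows "\<zeta> (Poly_Mapping.single m c) = c * \<zeta> (Poly_Mapping.single m 1)"
  using character_scale[OF assms, of c "Poly_Mapping.single m 1"] by (simp add: mult_single)

text \<open>\<open>F\<close> and the chains generate the algebra: every monomial is a product of
  powers of generators, and a character is linear and multiplicative. This yields injectivity of
  \<open>chain_series\<close>.\<close>

lemma character_ext:
  assumes \<chi>: "character \<chi>" and \<phi>: "character \<phi>"
    and F: "\<chi> F = \<phi> F" and C: "\<And>n. \<chi> (C n) = \<phi> (C n)"
  shows "\<chi> = \<phi>"
proof
  fix x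
  have var: "\<chi> (Poly_Mapping.single (Poly_Mapping.single g 1) 1) =
      \<phi> (Poly_Mapping.single (Poly_Mapping.single g 1) 1)" for g
    \<comment> \<open>The generator \<open>Chain k\<close> is \<open>C (Suc k)\<close>, since chains
      are indexed by length minus one.\<close>
    using F C[of "Suc _"] by (cases g) (simp_all add: F_def)
  have pow: "Poly_Mapping.single (Poly_Mapping.single g k) (1::'a) =
      Poly_Mapping.single (Poly_Mapping.single g 1) 1 ^ k" for g :: gen and k
  proof (induction k)
    case (Suc k)
    have "Poly_Mapping.single (Poly_Mapping.single g (Suc k)) (1::'a) =
        Poly_Mapping.single (Poly_Mapping.single g 1) 1 *
        Poly_Mapping.single (Poly_Mapping.single g k) 1"
      by (simp add: mult_single flip: single_add)
    then show ?case
      by (simp only: Suc power_Suc)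
  qed simp
  have mon: "\<chi> (Poly_Mapping.single m 1) = \<phi> (Poly_Mapping.single m 1)" for m
  proof (induction m rule: poly_mapping_add_induct)
    case (single g k)
    show ?case
      by (simp only: pow[of g k] character_power[OF \<chi>] character_power[OF \<phi>] var)
  next
    case (add m n)
    have "Poly_Mapping.single (m + n) (1::'a) =
        Poly_Mapping.single m 1 * Poly_Mapping.single n 1"
      by (simp add: mult_single)
    then show ?case
      by (simp only: character_mult[OF \<chi>] character_mult[OF \<phi>] add)
  qed
  show "\<chi> x = \<phi> x"
  proof (induction x rule: poly_mapping_add_induct)
    case (single m c)
    show ?case
      by (simp only: character_single[OF \<chi>, of m c] character_single[OF \<phi>, of m c] mon)
  qed (simp add: character_add[OF \<chi>] character_add[OF \<phi>])
qed

section \<open>Characters with prescribed values on the generators\<close>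

definition mon_eval :: "(gen \<Rightarrow> 'k::field_char_0) \<Rightarrow> mon \<Rightarrow> 'k" where
  "mon_eval v m = (\<Prod>g\<in>Poly_Mapping.keys m. v g ^ Poly_Mapping.lookup m g)"

definition CG_eval :: "(gen \<Rightarrow> 'k::field_char_0) \<Rightarrow> 'k CG \<Rightarrow> 'k" where
  "CG_eval v x = (\<Sum>m\<in>Poly_Mapping.keys x. Poly_Mapping.lookup x m * mon_eval v m)"

text \<open>Generators outside the support have exponent 0 and contribute a factor 1. Two monomials
  and their product can thus be evaluated over one common index set.\<close>

lemma mon_eval_superset:
  assumes "finite A" "Poly_Mapping.keys m \<subseteq> A"
  shows "mon_eval v m = (\<Prod>g\<in>A. v g ^ Poly_Mapping.lookup m g)"
  unfolding mon_eval_def using assms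
  by (intro prod.mono_neutral_left) (auto simp: in_keys_iff)

lemma mon_eval_add: "mon_eval v (m + n) = mon_eval v m * mon_eval v n"
proof -
  let ?A = "Poly_Mapping.keys m \<union> Poly_Mapping.keys n"
  have "mon_eval v (m + n) = (\<Prod>g\<in>?A. v g ^ Poly_Mapping.lookup (m + n) g)"
    by (rule mon_eval_superset) (auto simp: Poly_Mapping.keys_add)
  then show ?thesis
    by (simp add: lookup_add power_add prod.distrib mon_eval_superset[of ?A])
qed

lemma CG_eval_add: "CG_eval v (x + y) = CG_eval v x + CG_eval v y"
  unfolding CG_eval_def by (rule setsum_keys_plus_distrib) (simp_all add: ring_distribs)

lemma CG_eval_single: "CG_eval v (Poly_Mapping.single m c) = c * mon_eval v m"
  by (simp add: CG_eval_def)

lemma CG_eval_mult: "CG_eval v (x * y) = CG_eval v x * CG_eval v y"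
proof (induction x rule: poly_mapping_add_induct)
  case (single m a)
  show ?case
    by (induction y rule: poly_mapping_add_induct)
      (simp_all add: mult_single CG_eval_single mon_eval_add CG_eval_add ring_distribs)
qed (simp add: CG_eval_add ring_distribs)

lemma CG_eval_const: "CG_eval v (Poly_Mapping.single 0 c) = c"
  by (simp add: CG_eval_single mon_eval_def)

text \<open>Freeness of the polynomial algebra: any scalars assigned to the generators extend to a
  character. This is the source of surjectivity of \<open>chain_series\<close>.\<close>

lemma character_CG_eval: "character (CG_eval v)"
  using CG_eval_const[of v 1]
  by (simp add: character_def CG_eval_add CG_eval_mult CG_eval_const)

lemma CG_eval_F: "CG_eval v F = v Phantom"
  by (simp add: F_def CG_eval_single mon_eval_def)

lemma CG_eval_C: "CG_eval v (C (Suc n)) = v (Chain n)"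
  by (simp add: CG_eval_single mon_eval_def)

text \<open>Every monomial other than 1 contains a generator and so evaluates to 0. The counit is
  thereby a character that vanishes on \<open>F\<close> and on all nonempty chains.\<close>

lemma counit_eq_CG_eval: "counit = CG_eval (\<lambda>_. 0)"
proof
  fix x :: "'a CG"
  have mon: "mon_eval (\<lambda>_. 0::'a) m = (if m = 0 then 1 else 0)" for m
  proof (cases "m = 0")
    case False
    then obtain g where "g \<in> Poly_Mapping.keys m"
      by (metis keys_eq_empty all_not_in_conv)
    then show ?thesis
      using False unfolding mon_eval_def by (auto simp: in_keys_iff intro!: prod_zero)
  qed (simp add: mon_eval_def)
  show "counit x = CG_eval (\<lambda>_. 0) x"
    by (auto simp: counit_def CG_eval_def mon if_distrib in_keys_iff cong: if_cong)
qed


section \<open>Convolution of characters\<close>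

lemma tensor_eval_single:
  "tensor_eval \<chi> \<phi> (Poly_Mapping.single (m, n) c) =
     c * (\<chi> (Poly_Mapping.single m 1) * \<phi> (Poly_Mapping.single n 1))"
  by (simp add: tensor_eval_def)

context
  fixes \<chi> \<phi> :: "'k::field_char_0 CG \<Rightarrow> 'k"
  assumes \<chi>: "character \<chi>" and \<phi>: "character \<phi>"
begin

lemma tensor_eval_char_tensor: "tensor_eval \<chi> \<phi> (a \<otimes>\<^sub>t b) = \<chi> a * \<phi> b"
  by (intro tensor_eval_tensor character_add character_scale \<chi> \<phi>)

lemma tensor_eval_const: "tensor_eval \<chi> \<phi> (Poly_Mapping.single 0 c) = c"
  using tensor_eval_single[of \<chi> \<phi> 0 0 c] \<chi> \<phi>
  by (simp add: character_one flip: zero_prod_def)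

text \<open>Additivity in both arguments reduces the claim to pairs of monomials. These multiply
  componentwise, and the scalar values of \<open>\<chi>\<close> and \<open>\<phi>\<close>
  commute.\<close>

lemma tensor_eval_mult: "tensor_eval \<chi> \<phi> (s * t) = tensor_eval \<chi> \<phi> s * tensor_eval \<chi> \<phi> t"
proof (induction s rule: poly_mapping_add_induct)
  case (single p a)
  obtain m n where p: "p = (m, n)" by force
  show ?case
  proof (induction t rule: poly_mapping_add_induct)
    case (single q b)
    obtain m' n' where q: "q = (m', n')" by force
    have split: "Poly_Mapping.single (i + j) (1::'k) =
        Poly_Mapping.single i 1 * Poly_Mapping.single j 1" for i j :: mon
      by (simp add: mult_single)
    show ?case
      unfolding p q
      by (simp add: mult_single[of "(m, n)"] tensor_eval_single split
          character_mult[OF \<chi>] character_mult[OF \<phi>])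
  qed (simp add: tensor_eval_add ring_distribs)
qed (simp add: tensor_eval_add ring_distribs)

lemma tensor_eval_sum: "tensor_eval \<chi> \<phi> (\<Sum>i\<in>A. f i) = (\<Sum>i\<in>A. tensor_eval \<chi> \<phi> (f i))"
proof -
  have "tensor_eval \<chi> \<phi> 0 = 0"
    by (simp add: tensor_eval_def)
  then show ?thesis
    by (induction A rule: infinite_finite_induct) (simp_all add: tensor_eval_add)
qed

lemma tensor_eval_of_nat: "tensor_eval \<chi> \<phi> (of_nat n) = of_nat n"
  using tensor_eval_const[of 0] tensor_eval_const[of 1]
  by (induction n) (simp_all add: tensor_eval_add)

text \<open>A convolution is the composite of two algebra homomorphisms, \<open>coproduct\<close>
  and \<open>tensor_eval \<chi> \<phi>\<close>.\<close>

lemma character_convolution: "character (convolution \<chi> \<phi>)"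
  using tensor_eval_const[of 1]
  by (simp add: character_def convolution_def coproduct_add coproduct_mult coproduct_const
      coproduct_one tensor_eval_add tensor_eval_mult tensor_eval_const)

lemma convolution_F: "convolution \<chi> \<phi> F = \<chi> F + \<phi> F"
  using \<chi> \<phi>
  by (simp add: convolution_def coproduct_F tensor_eval_add tensor_eval_char_tensor character_one)

text \<open>All powers of \<open>F\<close> in the coproduct of a chain stand in the right-hand
  factors, which \<open>\<phi>\<close> evaluates. The double sum therefore collapses to a Cauchy
  product.\<close>

lemma convolution_C:
  assumes "\<phi> F = 0"
  shows "convolution \<chi> \<phi> (C n) = (\<Sum>i=0..n. \<chi> (C i) * \<phi> (C (n - i)))"
proof -
  have inner: "(\<Sum>j=0..n - m. of_nat ((n - m) choose j) *
      (\<chi> (C (j + 1)) * (\<phi> (C (m - 1)) * \<phi> F ^ (n - m - j)))) =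
      \<chi> (C (n - m + 1)) * \<phi> (C (m - 1))" for m
  proof -
    have "(\<Sum>j=0..n - m. of_nat ((n - m) choose j) *
        (\<chi> (C (j + 1)) * (\<phi> (C (m - 1)) * \<phi> F ^ (n - m - j)))) =
        (\<Sum>j\<in>{n - m}. of_nat ((n - m) choose j) *
        (\<chi> (C (j + 1)) * (\<phi> (C (m - 1)) * \<phi> F ^ (n - m - j))))"
      \<comment> \<open>For \<open>j < n - m\<close> a positive power of \<open>\<phi> F = 0\<close>
        occurs; at \<open>j = n - m\<close> the exponent is 0 and the binomial coefficient is
        1.\<close>
      by (rule sum.mono_neutral_right) (auto simp: assms)
    then show ?thesis by simp
  qed
  have "convolution \<chi> \<phi> (C n) =
      \<phi> (C n) + (\<Sum>m=1..n. \<chi> (C (n - m + 1)) * \<phi> (C (m - 1)))"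
    unfolding convolution_def coproduct_C tensor_eval_add tensor_eval_sum tensor_eval_mult
      tensor_eval_of_nat tensor_eval_char_tensor character_one[OF \<chi>] character_mult[OF \<phi>]
      character_power[OF \<phi>] inner by simp
  also have "(\<Sum>m=1..n. \<chi> (C (n - m + 1)) * \<phi> (C (m - 1))) =
      (\<Sum>i=1..n. \<chi> (C i) * \<phi> (C (n - i)))"
    \<comment> \<open>The substitution \<open>i = n + 1 - m\<close> is its own inverse on
      \<open>1..n\<close> and turns \<open>m - 1\<close> into \<open>n - i\<close>.\<close>
    by (rule sum.reindex_bij_witness[of _ "\<lambda>i. n + 1 - i" "\<lambda>m. n + 1 - m"])
      (auto simp: Suc_diff_le)
  \<comment> \<open>The isolated term is the summand at \<open>i = 0\<close>, because
    \<open>C 0 = 1\<close> and \<open>\<chi> 1 = 1\<close>.\<close>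
  also have "\<phi> (C n) + \<dots> = (\<Sum>i=0..n. \<chi> (C i) * \<phi> (C (n - i)))"
    by (simp add: sum.atLeast_Suc_atMost character_one[OF \<chi>])
  finally show ?thesis .
qed

end


section \<open>The generating function of an exorcism\<close>

definition chain_series :: "('k::field_char_0 CG \<Rightarrow> 'k) \<Rightarrow> 'k fps" where
  "chain_series \<zeta> = Abs_fps (\<lambda>n. \<zeta> (C n))"

lemma carrier_exorcism_group: "carrier exorcism_group = {\<zeta>. character \<zeta> \<and> \<zeta> F = 0}"
  by (simp add: exorcism_group_def character_group_def)

lemma mult_exorcism_group: "mult exorcism_group = convolution"
  by (simp add: exorcism_group_def character_group_def)

text \<open>Multiplicativity is the Cauchy product formula; injectivity holds because two exorcisms
  already agree on \<open>F\<close>. As \<open>iso\<close> asks only for a multiplicative bijection,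
  the group axioms can afterwards be transported along it.\<close>

lemma chain_series_iso:
  "chain_series \<in> iso exorcism_group (unit_series_group :: 'k::field_char_0 fps monoid)"
proof (rule isoI)
  show "chain_series \<in> hom exorcism_group unit_series_group"
    by (rule homI)
      (auto simp: carrier_exorcism_group mult_exorcism_group unit_series_group_def
        chain_series_def character_one convolution_C fps_mult_nth intro!: fps_ext)
  show "bij_betw chain_series (carrier exorcism_group)
      (carrier (unit_series_group :: 'k fps monoid))"
  proof (rule bij_betw_imageI)
    show "inj_on chain_series (carrier exorcism_group)"
      by (rule inj_onI)
        (auto simp: carrier_exorcism_group chain_series_def fps_eq_iff intro: character_ext)
    show "chain_series ` carrier exorcism_group =
        carrier (unit_series_group :: 'k fps monoid)"
    proof (intro equalityI subsetI)
      fix f :: "'k fps"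
      assume "f \<in> carrier unit_series_group"
      then have f0: "fps_nth f 0 = 1"
        by (simp add: unit_series_group_def)
      \<comment> \<open>The value 0 at \<open>Phantom\<close> puts the character into the exorcism
        group. \<open>Chain n\<close> has length \<open>n + 1\<close> and takes coefficient
        \<open>Suc n\<close>; coefficient 0 is matched by \<open>C 0 = 1\<close>, using
        \<open>f0\<close>.\<close>
      let ?\<zeta> = "CG_eval (case_gen 0 (\<lambda>n. fps_nth f (Suc n)))"
      have "?\<zeta> (C n) = fps_nth f n" for n
        by (cases n) (simp_all add: CG_eval_C f0 character_one[OF character_CG_eval] del: C.simps(2))
      then have "chain_series ?\<zeta> = f"
        by (simp add: chain_series_def fps_eq_iff)
      moreover have "?\<zeta> \<in> carrier exorcism_group"
        by (simp add: carrier_exorcism_group character_CG_eval CG_eval_F)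
      ultimately show "f \<in> chain_series ` carrier exorcism_group"
        by (metis image_eqI)
    qed (auto simp: carrier_exorcism_group unit_series_group_def chain_series_def character_one)
  qed
qed

section \<open>Group axioms on both sides\<close>

lemma chain_series_counit: "chain_series counit = 1"
proof (rule fps_ext)
  fix n
  show "fps_nth (chain_series counit) n = fps_nth (1 :: 'a fps) n"
    by (cases n) (simp_all add: chain_series_def counit_eq_CG_eval CG_eval_C
        character_one[OF character_CG_eval] del: C.simps(2))
qed

lemma group_unit_series_group: "group (unit_series_group :: 'k::field_char_0 fps monoid)"
proof (rule groupI)
  fix f :: "'k fps"
  assume "f \<in> carrier unit_series_group"
  then show "\<exists>g\<in>carrier unit_series_group. g \<otimes>\<^bsub>unit_series_group\<^esub> f = \<one>\<^bsub>unit_series_group\<^esub>"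
    \<comment> \<open>Constant coefficient 1 makes \<open>f\<close> invertible, and the inverse
      series again has constant coefficient 1.\<close>
    by (intro bexI[of _ "inverse f"]) (simp_all add: unit_series_group_def inverse_mult_eq_1)
qed (simp_all add: unit_series_group_def mult.assoc)

text \<open>Associativity and inverses are carried over from power series: the exorcism group is the
  image of a group under the inverse of \<open>chain_series\<close>.\<close>

lemma group_exorcism_group: "group (exorcism_group :: ('k::field_char_0 CG \<Rightarrow> 'k) monoid)"
proof -
  let ?G = "exorcism_group :: ('k CG \<Rightarrow> 'k) monoid"
  let ?h = "inv_into (carrier ?G) chain_series"
  interpret U: group "unit_series_group :: 'k fps monoid"
    by (rule group_unit_series_group)
  \<comment> \<open>\<open>F\<close> is primitive, so convolution adds the values at
    \<open>F\<close>, and 0 + 0 = 0.\<close>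
  have closed: "x \<otimes>\<^bsub>?G\<^esub> y \<in> carrier ?G" if "x \<in> carrier ?G" "y \<in> carrier ?G" for x y
    using that by (simp add: carrier_exorcism_group mult_exorcism_group character_convolution
        convolution_F)
  have bij: "bij_betw chain_series (carrier ?G) (carrier unit_series_group)"
    using chain_series_iso[where ?'k = 'k] by (simp add: iso_def)
  have hom: "?h \<in> hom unit_series_group ?G"
  proof (rule homI)
    fix f assume "f \<in> carrier (unit_series_group :: 'k fps monoid)"
    then show "?h f \<in> carrier ?G"
      by (intro inv_into_into) (simp only: bij_betw_imp_surj_on[OF bij])
  next
    fix f g :: "'k fps"
    assume "f \<in> carrier unit_series_group" "g \<in> carrier unit_series_group"
    then have "f \<in> chain_series ` carrier ?G" "g \<in> chain_series ` carrier ?G"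
      by (simp_all only: bij_betw_imp_surj_on[OF bij])
    then obtain x y where xy: "x \<in> carrier ?G" "y \<in> carrier ?G"
        "f = chain_series x" "g = chain_series y"
      by (elim imageE)
    have "f \<otimes>\<^bsub>unit_series_group\<^esub> g = chain_series (x \<otimes>\<^bsub>?G\<^esub> y)"
      using hom_mult[OF Group.iso_imp_homomorphism[OF chain_series_iso[where ?'k = 'k]] xy(1,2)]
      by (simp only: xy(3,4))
    then show "?h (f \<otimes>\<^bsub>unit_series_group\<^esub> g) = ?h f \<otimes>\<^bsub>?G\<^esub> ?h g"
      using xy closed bij by (simp add: bij_betw_inv_into_left)
  qed
  \<comment> \<open>The image group has unit \<open>?h 1\<close>, which must be identified with the
    unit in the record \<open>?G\<close>.\<close>
  have "?h 1 = counit"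
    using bij_betw_inv_into_left[OF bij, of counit] chain_series_counit[where ?'a = 'k]
    by (simp add: carrier_exorcism_group counit_eq_CG_eval character_CG_eval CG_eval_F)
  moreover have "?h ` carrier unit_series_group = carrier ?G"
    by (rule bij_betw_imp_surj_on[OF bij_betw_inv_into[OF bij]])
  \<comment> \<open>Replacing the carrier and the unit by their images leaves \<open>?G\<close>
    unchanged, so the statement about the image group is one about \<open>?G\<close>.\<close>
  ultimately have "?G\<lparr>carrier := ?h ` carrier unit_series_group,
      one := ?h \<one>\<^bsub>unit_series_group\<^esub>\<rparr> = ?G"
    by (simp add: unit_series_group_def exorcism_group_def character_group_def)
  then show ?thesis
    using U.hom_imp_img_group[OF hom] by simp
qed

theorem theorem6p2:
  shows "group (exorcism_group :: ('k::field_char_0 CG \<Rightarrow> 'k) monoid) \<and>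
    group (unit_series_group :: 'k fps monoid) \<and>
    (exorcism_group :: ('k CG \<Rightarrow> 'k) monoid) \<cong> (unit_series_group :: 'k fps monoid)"
  using group_exorcism_group group_unit_series_group chain_series_iso
  by (auto simp: is_iso_def)

end
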